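(* Let $\alpha\in[-1/2,1)$, $\zeta\in\mathbb{C}$ with $|\zeta|\le\frac13$, and let $f=h+\overline{g}\in\mathcal{M}(\alpha,\zeta,2)$. Then $$|T_{3}(2)[h]|\leq\begin{cases}\frac{1}{108}(1-\alpha)^3(2\alpha^2-7\alpha+12)(10\alpha^2-27\alpha+36) & \left(-\frac12\le\alpha\le\frac17\right),\\[4pt] \frac{5}{108}(1-\alpha)^3(2\alpha^2-7\alpha+12)(2\alpha^2-4\alpha+7) & \left(\frac17\le\alpha<1\right),\end{cases}$$ and $$|T_{3}(2)[g]|=|2b_3^2b_4|\leq\frac{1}{243}(1-\alpha).$$ The first inequality is sharp: equality is attained by the function $h(z)=\int_0^z\frac{dt}{(1-\delta t)^{2-2\alpha}}$ for suitable $\delta$ with $|\delta|=1$. The second inequality is sharp: equality is attained by the function $g(z)=\int_0^z\frac{\zeta t^2}{(1-\delta t)^{2-2\alpha}}\,dt$ for suitable $\delta,\zeta$ with $|\delta|=1$, $|\zeta|\le\frac13$.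
   Context: $\mathbb{D}=\{z\in\mathbb{C}:|z|<1\}$. $\mathcal{H}$ is the class of sense-preserving harmonic mappings $f=h+\overline{g}$ in $\mathbb{D}$ (i.e. $|h'|>|g'|$ in $\mathbb{D}$), where $h(z)=z+\sum_{k=2}^\infty a_kz^k$ and $g(z)=\sum_{k=1}^\infty b_kz^k$ are analytic in $\mathbb{D}$. For $-1/2\le\alpha<1$, $\mathcal{K}(\alpha)$ is the class of analytic functions $h$ in $\mathbb{D}$ with $h(0)=h'(0)-1=0$ and $\operatorname{Re}\left(1+\frac{zh''(z)}{h'(z)}\right)>\alpha$ for $z\in\mathbb{D}$. For $\alpha\in[-1/2,1)$ and $\zeta\in\mathbb{C}$ with $|\zeta|\le\frac13$, $\mathcal{M}(\alpha,\zeta,2)$ is the class of $f=h+\overline{g}\in\mathcal{H}$ such that $h\in\mathcal{K}(\alpha)$ and $g'(z)=\zeta z^2h'(z)$ in $\mathbb{D}$. For an analytic function $F(z)=\sum_{k\ge1}c_kz^k$, the symmetric Toeplitz determinant $T_q(n)[F]$ ($q,n\in\mathbb{N}$) is the determinant of the $q\times q$ matrix whose $(i,j)$ entry is $c_{n+|i-j|}$. Thus $T_3(2)[h]=\begin{vmatrix} a_2 & a_3 & a_4 \\ {} a_3 & a_2 & a_3 \\ {} a_4 & a_3 & a_2 \end{vmatrix}$ and $T_3(2)[g]$ is the same determinant with $b_k$ in place of $a_k$.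
   Formalization: Sharpness of the first inequality is stated only for −1/2 ≤ α ≤ 1/7; for 1/7 < α < 1 the displayed h never attains the bound (at α = 1/2 its maximum over δ is 25/96 < 55/192), so the claim is false there. *)

theory Defs
  imports "HOL-Complex_Analysis.Complex_Analysis" "Jordan_Normal_Form.Determinant"
begin

text \<open>
  A harmonic mapping \<open>f = h + cnj g\<close> of the unit disc is always considered together with its
  normalised representation, so the predicates on \<open>f\<close> also take the analytic part \<open>h\<close> and the
  co-analytic part \<open>g\<close>, which \<open>h 0 = g 0 = 0\<close> makes unique on the disc. All functions are total;
  their values outside the disc are irrelevant.
\<close>

definition harmonic_class_H ::
    "(complex \<Rightarrow> complex) \<Rightarrow> (complex \<Rightarrow> complex) \<Rightarrow> (complex \<Rightarrow> complex) \<Rightarrow> bool" where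
  "harmonic_class_H f h g \<longleftrightarrow>
     h holomorphic_on ball 0 1 \<and> g holomorphic_on ball 0 1 \<and>
     h 0 = 0 \<and> deriv h 0 = 1 \<and> g 0 = 0 \<and>
     (\<forall>z\<in>ball 0 1. f z = h z + cnj (g z)) \<and>
     (\<forall>z\<in>ball 0 1. cmod (deriv g z) < cmod (deriv h z))"

text \<open>
  The condition \<open>deriv h z \<noteq> 0\<close> is implicit in the quotient; it is spelled out because of the
  convention \<open>x / 0 = 0\<close>.
\<close>

definition convex_class_K :: "real \<Rightarrow> (complex \<Rightarrow> complex) set" where
  "convex_class_K \<alpha> =
     {h. h holomorphic_on ball 0 1 \<and> h 0 = 0 \<and> deriv h 0 = 1 \<and>
         (\<forall>z\<in>ball 0 1. deriv h z \<noteq> 0 \<and> Re (1 + z * deriv (deriv h) z / deriv h z) > \<alpha>)}"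

text \<open>The class \<open>M(\<alpha>, \<zeta>, 2)\<close>, meant for \<open>-1/2 \<le> \<alpha> < 1\<close> and \<open>cmod \<zeta> \<le> 1/3\<close>.\<close>

definition harmonic_class_M2 ::
    "real \<Rightarrow> complex \<Rightarrow> (complex \<Rightarrow> complex) \<Rightarrow> (complex \<Rightarrow> complex) \<Rightarrow> (complex \<Rightarrow> complex) \<Rightarrow> bool"
  where
  "harmonic_class_M2 \<alpha> \<zeta> f h g \<longleftrightarrow>
     harmonic_class_H f h g \<and> h \<in> convex_class_K \<alpha> \<and>
     (\<forall>z\<in>ball 0 1. deriv g z = \<zeta> * z\<^sup>2 * deriv h z)"

definition taylor_coeff :: "(complex \<Rightarrow> complex) \<Rightarrow> nat \<Rightarrow> complex" where
  "taylor_coeff F k = fps_nth (fps_expansion F 0) k"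

definition toeplitz_det :: "nat \<Rightarrow> nat \<Rightarrow> (complex \<Rightarrow> complex) \<Rightarrow> complex" where
  "toeplitz_det q n F =
     Determinant.det (mat q q (\<lambda>(i, j). taylor_coeff F (n + nat \<bar>int i - int j\<bar>)))"

text \<open>
  The powers below are principal: \<open>Re (1 - \<delta> * t) > 0\<close> for \<open>cmod t < 1\<close> and \<open>cmod \<delta> = 1\<close>.
\<close>

definition extremal_h :: "real \<Rightarrow> complex \<Rightarrow> complex \<Rightarrow> complex" where
  "extremal_h \<alpha> \<delta> z =
     contour_integral (linepath 0 z) (\<lambda>t. 1 / (1 - \<delta> * t) powr of_real (2 - 2 * \<alpha>))"

definition extremal_g :: "real \<Rightarrow> complex \<Rightarrow> complex \<Rightarrow> complex \<Rightarrow> complex" where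
  "extremal_g \<alpha> \<delta> \<zeta> z =
     contour_integral (linepath 0 z) (\<lambda>t. \<zeta> * t\<^sup>2 / (1 - \<delta> * t) powr of_real (2 - 2 * \<alpha>))"

end

theory Submission
  imports Defs
begin

text \<open>
  Write \<open>\<beta> = 1 - \<alpha>\<close>. For \<open>h\<close> in \<open>K(\<alpha>)\<close> the function \<open>p = 1 + (z h'' / h') / \<beta>\<close> is a Caratheodory
  function: \<open>p 0 = 1\<close> and \<open>Re p > 0\<close>. Comparing coefficients in \<open>z h'' = \<beta> (p - 1) h'\<close> expresses
  \<open>a\<^sub>2, a\<^sub>3, a\<^sub>4\<close> through the coefficients \<open>p\<^sub>1, p\<^sub>2, p\<^sub>3\<close> of \<open>p\<close>
  (\<open>taylor_coeffs_of_log_derivative\<close>). The determinant factors as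
  \<open>(a\<^sub>2 - a\<^sub>4) (a\<^sub>2\<^sup>2 + a\<^sub>2 a\<^sub>4 - 2 a\<^sub>3\<^sup>2)\<close> (\<open>toeplitz_det_3_2\<close>), and each factor is bounded
  separately (\<open>toeplitz_factor_bound\<close>). The first factor needs only \<open>|p\<^sub>n| \<le> 2\<close>. The second equals
  \<open>\<beta>\<^sup>2 / 72\<close> times
  \<open>18 p\<^sub>1\<^sup>2 + 3 p\<^sub>1 (p\<^sub>3 - \<mu> p\<^sub>1 p\<^sub>2) - (5/2) \<beta>\<^sup>2 p\<^sub>1^4 - 4 p\<^sub>2\<^sup>2\<close> with \<open>\<mu> = 7 \<beta> / 6\<close>,
  and the triangle inequality with \<open>|p\<^sub>3 - \<mu> p\<^sub>1 p\<^sub>2| \<le> max 2 (4 \<mu> - 2)\<close> finishes it; the case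
  distinction at \<open>\<alpha> = 1/7\<close> is the one at \<open>\<mu> = 1\<close>.

  That last estimate reduces to Livingston's inequality \<open>|p\<^sub>3 - p\<^sub>1 p\<^sub>2| \<le> 2\<close>
  (\<open>caratheodory_coeff_3_bound\<close>). It is proved without the Herglotz representation, by integrating
  against the positive density \<open>Re p\<close> on circles of radius \<open>r < 1\<close> and letting \<open>r\<close> tend to 1.

  For \<open>g\<close>, the relation \<open>g' = \<zeta> z\<^sup>2 h'\<close> gives \<open>b\<^sub>2 = 0\<close>, \<open>b\<^sub>3 = \<zeta> / 3\<close> and \<open>b\<^sub>4 = \<zeta> a\<^sub>2 / 2\<close>, so its
  determinant is \<open>\<zeta>\<^sup>3 a\<^sub>2 / 9\<close>. The extremal \<open>h\<close> has \<open>p = (1 + \<delta> z) / (1 - \<delta> z)\<close>; with \<open>\<delta> = \<i>\<close> it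
  attains the bound for \<open>\<alpha> \<le> 1/7\<close>, while for \<open>g\<close> the choice \<open>\<delta> = 1\<close>, \<open>\<zeta> = 1/3\<close> works.
\<close>

section \<open>Coefficients of functions with positive real part\<close>

lemma taylor_coeff_eq_deriv: "taylor_coeff F n = (deriv ^^ n) F 0 / fact n"
  by (simp add: taylor_coeff_def fps_expansion_def)

lemma taylor_coeff_0 [simp]: "taylor_coeff F 0 = F 0"
  by (simp add: taylor_coeff_eq_deriv)

lemma taylor_coeff_1: "taylor_coeff F (Suc 0) = deriv F 0"
  by (simp add: taylor_coeff_eq_deriv)

lemma circle_integral_taylor_coeff:
  assumes p: "p holomorphic_on ball 0 1" and r: "0 < r" "r < 1"
  shows "((\<lambda>t. p (of_real r * cis t) * cis (- (real n * t))) has_integral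
           of_real (2 * pi * r ^ n) * taylor_coeff p n) {0..2 * pi}"
proof -
  have sub: "cball 0 r \<subseteq> ball (0::complex) 1" using r by auto
  have "((\<lambda>u. p u / (u - 0) ^ Suc n) has_contour_integral
      (2 * pi * \<i>) / fact n * (deriv ^^ n) p 0) (circlepath 0 r)"
    using r sub by (intro Cauchy_has_contour_integral_higher_derivative_circlepath)
      (auto intro: holomorphic_on_imp_continuous_on holomorphic_on_subset[OF p])
  hence "((\<lambda>t. p (of_real r * cis t) / (of_real r * cis t) ^ Suc n * of_real r * \<i> * cis t)
      has_integral (2 * pi * \<i>) / fact n * (deriv ^^ n) p 0) {0..2 * pi}"
    unfolding circlepath_def by (subst (asm) has_contour_integral_part_circlepath_iff) auto
  hence "((\<lambda>t. (of_real r ^ n / \<i>) *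
        (p (of_real r * cis t) / (of_real r * cis t) ^ Suc n * of_real r * \<i> * cis t))
      has_integral (of_real r ^ n / \<i>) * ((2 * pi * \<i>) / fact n * (deriv ^^ n) p 0)) {0..2 * pi}"
    by (rule has_integral_mult_right)
  moreover have "(of_real r ^ n / \<i>) *
        (p (of_real r * cis t) / (of_real r * cis t) ^ Suc n * of_real r * \<i> * cis t) =
      p (of_real r * cis t) * cis (- (real n * t))" for t
  proof -
    have "cis (- (real n * t)) = inverse (cis t ^ n)"
      by (simp only: Complex.DeMoivre cis_inverse)
    thus ?thesis using r by (simp add: field_simps power_mult_distrib)
  qed
  moreover have "(of_real r ^ n / \<i>) * ((2 * pi * \<i>) / fact n * (deriv ^^ n) p 0) =
      of_real (2 * pi * r ^ n) * taylor_coeff p n"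
    by (simp add: taylor_coeff_eq_deriv field_simps)
  ultimately show ?thesis by simp
qed

lemma circle_integral_eq_0:
  assumes p: "p holomorphic_on ball 0 1" and r: "0 < r" "r < 1" and n: "n > 0"
  shows "((\<lambda>t. p (of_real r * cis t) * cis (real n * t)) has_integral 0) {0..2 * pi}"
proof -
  obtain m where m: "n = Suc m" using n by (cases n) auto
  have "((\<lambda>u. p u * u ^ m) has_contour_integral 0) (circlepath 0 r)"
  proof (rule Cauchy_theorem_disc_simple)
    show "(\<lambda>u. p u * u ^ m) holomorphic_on ball 0 1" by (intro holomorphic_intros p)
  qed (use r in auto)
  hence "((\<lambda>t. p (of_real r * cis t) * (of_real r * cis t) ^ m * of_real r * \<i> * cis t)
      has_integral 0) {0..2 * pi}"
    unfolding circlepath_def by (subst (asm) has_contour_integral_part_circlepath_iff) auto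
  hence "((\<lambda>t. (1 / (of_real r ^ n * \<i>)) *
       (p (of_real r * cis t) * (of_real r * cis t) ^ m * of_real r * \<i> * cis t))
      has_integral (1 / (of_real r ^ n * \<i>)) * 0) {0..2 * pi}"
    by (rule has_integral_mult_right)
  moreover have "(1 / (of_real r ^ n * \<i>)) *
       (p (of_real r * cis t) * (of_real r * cis t) ^ m * of_real r * \<i> * cis t) =
      p (of_real r * cis t) * cis (real n * t)" for t
  proof -
    have "cis (real n * t) = cis t * cis t ^ m"
      by (simp only: m Complex.DeMoivre[symmetric] power_Suc)
    thus ?thesis using r by (simp add: m field_simps power_mult_distrib)
  qed
  ultimately show ?thesis by simp
qed

text \<open>
  The \<open>n\<close>-th Fourier coefficient of \<open>cnj p\<close> on the circle vanishes for \<open>n > 0\<close>, so \<open>p\<close> may be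
  replaced by its real part at the cost of a factor 2.
\<close>

lemma circle_integral_Re:
  assumes p: "p holomorphic_on ball 0 1" and r: "0 < r" "r < 1" and n: "n > 0"
  shows "((\<lambda>t. of_real (Re (p (of_real r * cis t))) * cis (- (real n * t))) has_integral
           of_real (pi * r ^ n) * taylor_coeff p n) {0..2 * pi}"
proof -
  have "((\<lambda>t. cnj (p (of_real r * cis t) * cis (real n * t))) has_integral cnj 0) {0..2 * pi}"
    by (intro has_integral_cnj[unfolded comp_def, THEN iffD2] circle_integral_eq_0 assms)
  hence "((\<lambda>t. (1/2) * (p (of_real r * cis t) * cis (- (real n * t)) +
        cnj (p (of_real r * cis t) * cis (real n * t)))) has_integral
      (1/2) * (of_real (2 * pi * r ^ n) * taylor_coeff p n + cnj 0)) {0..2 * pi}"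
    by (intro has_integral_mult_right has_integral_add circle_integral_taylor_coeff[OF p r])
  moreover have "(1/2) * (p z * cis (- x) + cnj (p z * cis x)) = of_real (Re (p z)) * cis (- x)"
    for z x
    by (simp add: complex_eq_iff field_simps)
  moreover have "(1/2) * (of_real (2 * pi * r ^ n) * taylor_coeff p n + cnj 0) =
      of_real (pi * r ^ n) * taylor_coeff p n" by simp
  ultimately show ?thesis by (simp only:)
qed

lemma circle_integral_Re_0:
  assumes p: "p holomorphic_on ball 0 1" and r: "0 < r" "r < 1" and "p 0 = 1"
  shows "((\<lambda>t. Re (p (of_real r * cis t))) has_integral 2 * pi) {0..2 * pi}"
  using has_integral_Re[OF circle_integral_taylor_coeff[OF p r, of 0]] assms by simp

lemma le_if_mult_power_le:
  fixes c C :: real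
  assumes "\<And>r. 0 < r \<Longrightarrow> r < 1 \<Longrightarrow> r ^ n * c \<le> C"
  shows "c \<le> C"
proof (rule tendsto_upperbound)
  show "((\<lambda>r. r ^ n * c) \<longlongrightarrow> c) (at_left (1::real))"
    by (rule tendsto_eq_intros refl | simp)+
  show "eventually (\<lambda>r. r ^ n * c \<le> C) (at_left (1::real))"
    using eventually_at_left_real[of 0 "1::real"] by (rule eventually_mono) (use assms in auto)
qed auto

lemma caratheodory_coeff_bound:
  assumes p: "p holomorphic_on ball 0 1" "p 0 = 1" and pos: "\<forall>z\<in>ball 0 1. Re (p z) \<ge> 0"
    and n: "n > 0"
  shows "cmod (taylor_coeff p n) \<le> 2"
proof (rule le_if_mult_power_le)
  fix r :: real assume r: "0 < r" "r < 1"
  note A = circle_integral_Re[OF p(1) r n] and B = circle_integral_Re_0[OF p(1) r p(2)]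
  have "cmod (integral {0..2*pi} (\<lambda>t. of_real (Re (p (of_real r * cis t))) * cis (- (real n * t))))
      \<le> integral {0..2*pi} (\<lambda>t. Re (p (of_real r * cis t)))"
    using A B r by (intro integral_norm_bound_integral)
      (auto simp: norm_mult integrable_on_def intro!: pos[rule_format])
  hence "pi * (r ^ n * cmod (taylor_coeff p n)) \<le> pi * 2"
    using integral_unique[OF A] integral_unique[OF B] r by (simp add: norm_mult norm_power)
  thus "r ^ n * cmod (taylor_coeff p n) \<le> 2" by simp
qed

text \<open>
  Livingston's inequality. Let \<open>\<nu>\<close> be the probability measure \<open>Re p dt / (2 \<pi>)\<close> on the circle of
  radius \<open>r\<close>, let \<open>x = cis (- t)\<close> and \<open>q\<^sub>n = p\<^sub>n r^n\<close>, so that \<open>q\<^sub>n = 2 \<integral> x^n d\<nu>\<close>. Then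
  \<open>q\<^sub>3 - q\<^sub>1 q\<^sub>2 = 2 \<integral> x (x\<^sup>2 - q\<^sub>2) d\<nu>\<close>. Here \<open>|x| = 1\<close>, and \<open>\<integral> |x\<^sup>2 - q\<^sub>2|\<^sup>2 d\<nu> = 1\<close> because the mean
  of \<open>x\<^sup>2\<close> is \<open>q\<^sub>2 / 2\<close>; hence the pointwise bound \<open>s \<le> (1 + s\<^sup>2) / 2\<close> for \<open>s = |x\<^sup>2 - q\<^sub>2|\<close> yields the claim.
\<close>

lemma caratheodory_coeff_3_bound:
  assumes p: "p holomorphic_on ball 0 1" "p 0 = 1" and pos: "\<forall>z\<in>ball 0 1. Re (p z) \<ge> 0"
  shows "cmod (taylor_coeff p 3 - taylor_coeff p 1 * taylor_coeff p 2) \<le> 2"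
proof (rule le_if_mult_power_le)
  fix r :: real assume r: "0 < r" "r < 1"
  define u where "u = (\<lambda>t. Re (p (of_real r * cis t)))"
  define q where "q = (\<lambda>n. of_real (r ^ n) * taylor_coeff p n)"
  have u0: "u t \<ge> 0" for t using r by (auto simp: u_def norm_mult intro!: pos[rule_format])
  have I: "((\<lambda>t. of_real (u t) * cis (- (real n * t))) has_integral of_real pi * q n) {0..2*pi}"
    if "n > 0" for n
    using circle_integral_Re[OF p(1) r that] by (simp add: u_def q_def mult_ac)
  have I0: "(u has_integral 2 * pi) {0..2*pi}"
    using circle_integral_Re_0[OF p(1) r p(2)] by (simp add: u_def)
  define F where "F = (\<lambda>t. of_real (u t) * (cis (- t) * (cis (- (2 * t)) - q 2)))"
  define G where "G = (\<lambda>t. u t * ((1 + (cmod (cis (- (2 * t)) - q 2))\<^sup>2) / 2))"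
  have F: "(F has_integral of_real pi * (q 3 - q 1 * q 2)) {0..2*pi}"
  proof -
    have "((\<lambda>t. of_real (u t) * cis (- (real 3 * t)) - of_real (u t) * cis (- (real 1 * t)) * q 2)
        has_integral of_real pi * q 3 - of_real pi * q 1 * q 2) {0..2*pi}"
      by (intro has_integral_diff has_integral_mult_left I) auto
    moreover have "of_real (u t) * cis (- (real 3 * t)) - of_real (u t) * cis (- (real 1 * t)) * q 2
        = F t" for t
      by (simp add: F_def algebra_simps cis_mult)
    ultimately show ?thesis by (simp add: algebra_simps)
  qed
  have G: "(G has_integral 2 * pi) {0..2*pi}"
  proof -
    have "((\<lambda>t. u t * (1 + (cmod (q 2))\<^sup>2 / 2) -
          Re (cnj (q 2) * (of_real (u t) * cis (- (real 2 * t))))) has_integral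
        2 * pi * (1 + (cmod (q 2))\<^sup>2 / 2) - Re (cnj (q 2) * (of_real pi * q 2))) {0..2*pi}"
      by (intro has_integral_diff has_integral_mult_left has_integral_Re
          has_integral_mult_right I I0) auto
    moreover have "u t * (1 + (cmod (q 2))\<^sup>2 / 2) -
          Re (cnj (q 2) * (of_real (u t) * cis (- (real 2 * t)))) = G t" for t
    proof -
      have "(cmod (cis (- (2 * t)) - q 2))\<^sup>2 = 1 + (cmod (q 2))\<^sup>2 - 2 * Re (cnj (q 2) * cis (- (2 * t)))"
        using sin_cos_squared_add[of "2 * t"]
        unfolding cmod_power2 by (simp add: power2_eq_square algebra_simps)
      moreover have "Re (cnj (q 2) * (of_real (u t) * cis (- (real 2 * t)))) =
          u t * Re (cnj (q 2) * cis (- (2 * t)))"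
        by (simp add: algebra_simps)
      ultimately show ?thesis by (simp only: G_def) (simp add: field_simps)
    qed
    moreover have "2 * pi * (1 + (cmod (q 2))\<^sup>2 / 2) - Re (cnj (q 2) * (of_real pi * q 2)) = 2 * pi"
      unfolding cmod_power2 by (simp add: power2_eq_square algebra_simps)
    ultimately show ?thesis by simp
  qed
  have "cmod (integral {0..2*pi} F) \<le> integral {0..2*pi} G"
  proof (rule integral_norm_bound_integral)
    show "cmod (F t) \<le> G t" for t
    proof -
      have "x \<le> (1 + x\<^sup>2) / 2" for x :: real
        using zero_le_power2[of "x - 1"] by (simp add: power2_diff)
      thus ?thesis using u0[of t] unfolding F_def G_def
        by (simp only: norm_mult norm_of_real norm_cis abs_of_nonneg mult_1 mult_left_mono)
    qed
  qed (use F G in \<open>auto simp: integrable_on_def\<close>)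
  hence "pi * cmod (q 3 - q 1 * q 2) \<le> pi * 2"
    using integral_unique[OF F] integral_unique[OF G] by (simp add: norm_mult)
  hence "cmod (q 3 - q 1 * q 2) \<le> 2" by simp
  moreover have "q 3 - q 1 * q 2 = of_real (r ^ 3) * (taylor_coeff p 3 - taylor_coeff p 1 * taylor_coeff p 2)"
    by (simp add: q_def algebra_simps eval_nat_numeral)
  ultimately show "r ^ 3 * cmod (taylor_coeff p 3 - taylor_coeff p 1 * taylor_coeff p 2) \<le> 2"
    using r by (simp add: norm_mult norm_power)
qed

section \<open>Taylor coefficients of the analytic and co-analytic parts\<close>

lemma taylor_coeffs_of_log_derivative:
  assumes h: "h holomorphic_on ball 0 1" "deriv h 0 = 1"
    and p: "p holomorphic_on ball 0 1" "p 0 = 1"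
    and eq: "\<forall>z\<in>ball 0 1. z * deriv (deriv h) z = \<beta> * (p z - 1) * deriv h z"
  defines "p1 \<equiv> taylor_coeff p 1" and "p2 \<equiv> taylor_coeff p 2" and "p3 \<equiv> taylor_coeff p 3"
  shows "taylor_coeff h 2 = \<beta> * p1 / 2"
    and "taylor_coeff h 3 = \<beta> * (p2 + \<beta> * p1\<^sup>2) / 6"
    and "taylor_coeff h 4 = \<beta> * (p3 + 3/2 * \<beta> * p1 * p2 + \<beta>\<^sup>2 * p1^3 / 2) / 12"
proof -
  define H P where "H = fps_expansion h 0" and "P = fps_expansion p 0"
  have H: "h has_fps_expansion H" and P: "p has_fps_expansion P"
    unfolding H_def P_def using h p by (auto intro!: has_fps_expansion_fps_expansion[of "ball 0 1"])
  have L: "(\<lambda>z. z * deriv (deriv h) z) has_fps_expansion fps_X * fps_deriv (fps_deriv H)"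
    by (intro has_fps_expansion_mult has_fps_expansion_deriv has_fps_expansion_fps_X H)
  have R: "(\<lambda>z. \<beta> * (p z - 1) * deriv h z) has_fps_expansion
      fps_const \<beta> * (P - 1) * fps_deriv H"
    by (intro has_fps_expansion_mult has_fps_expansion_deriv has_fps_expansion_diff
        has_fps_expansion_cmult_left has_fps_expansion_1 H P)
  have "eventually (\<lambda>z. z * deriv (deriv h) z = \<beta> * (p z - 1) * deriv h z) (nhds 0)"
    using eventually_nhds_in_open[of "ball 0 1" "0::complex"] by (rule eventually_mono) (use eq in auto)
  from has_fps_expansion_cong[OF this refl] R
  have "(\<lambda>z. z * deriv (deriv h) z) has_fps_expansion fps_const \<beta> * (P - 1) * fps_deriv H"
    by simp
  from fps_expansion_unique_complex[OF L this]
  have E: "fps_nth (fps_X * fps_deriv (fps_deriv H)) n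
      = fps_nth (fps_const \<beta> * ((P - 1) * fps_deriv H)) n" for n
    by (simp add: mult.assoc)
  have nth: "fps_nth H n = taylor_coeff h n" "fps_nth P n = taylor_coeff p n" for n
    by (simp_all add: H_def P_def taylor_coeff_def)
  have a1: "taylor_coeff h (Suc 0) = 1" using h by (simp add: taylor_coeff_1)
  have e1: "2 * taylor_coeff h 2 = \<beta> * p1"
    using E[of 1] by (simp add: fps_mult_nth nth a1 p p1_def numeral_2_eq_2)
  have e2: "6 * taylor_coeff h 3 = \<beta> * (p2 + 2 * taylor_coeff h 2 * p1)"
    using E[of 2] by (simp add: fps_mult_nth nth a1 p p1_def p2_def eval_nat_numeral algebra_simps)
  have e3: "12 * taylor_coeff h 4 = \<beta> * (p3 + 2 * taylor_coeff h 2 * p2 + 3 * taylor_coeff h 3 * p1)"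
    using E[of 3] by (simp add: fps_mult_nth nth a1 p p1_def p2_def p3_def eval_nat_numeral algebra_simps)
  show a2: "taylor_coeff h 2 = \<beta> * p1 / 2" using e1 by (simp add: field_simps)
  show a3: "taylor_coeff h 3 = \<beta> * (p2 + \<beta> * p1\<^sup>2) / 6"
    using e2 a2 by (simp add: field_simps power2_eq_square)
  show "taylor_coeff h 4 = \<beta> * (p3 + 3/2 * \<beta> * p1 * p2 + \<beta>\<^sup>2 * p1^3 / 2) / 12"
  proof -
    have "taylor_coeff h 4 = (12 * taylor_coeff h 4) / 12" by simp
    also have "\<dots> = \<beta> * (p3 + 3/2 * \<beta> * p1 * p2 + \<beta>\<^sup>2 * p1^3 / 2) / 12"
      unfolding e3 a2 a3 by (simp add: field_simps power2_eq_square power3_eq_cube)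
    finally show ?thesis .
  qed
qed

lemma taylor_coeffs_coanalytic:
  assumes h: "h holomorphic_on ball 0 1" "deriv h 0 = 1"
    and g: "g holomorphic_on ball 0 1"
    and eq: "\<forall>z\<in>ball 0 1. deriv g z = \<zeta> * z\<^sup>2 * deriv h z"
  shows "taylor_coeff g 2 = 0" "taylor_coeff g 3 = \<zeta> / 3"
    "taylor_coeff g 4 = \<zeta> * taylor_coeff h 2 / 2"
proof -
  define H G where "H = fps_expansion h 0" and "G = fps_expansion g 0"
  have H: "h has_fps_expansion H" and G: "g has_fps_expansion G"
    unfolding H_def G_def using h g by (auto intro!: has_fps_expansion_fps_expansion[of "ball 0 1"])
  have L: "deriv g has_fps_expansion fps_deriv G" by (intro has_fps_expansion_deriv G)
  have R: "(\<lambda>z. \<zeta> * z\<^sup>2 * deriv h z) has_fps_expansion fps_const \<zeta> * fps_X\<^sup>2 * fps_deriv H"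
    by (intro has_fps_expansion_mult has_fps_expansion_deriv has_fps_expansion_cmult_left
        has_fps_expansion_fps_X_power H)
  have "eventually (\<lambda>z. deriv g z = \<zeta> * z\<^sup>2 * deriv h z) (nhds 0)"
    using eventually_nhds_in_open[of "ball 0 1" "0::complex"] by (rule eventually_mono) (use eq in auto)
  from has_fps_expansion_cong[OF this refl] R
  have "deriv g has_fps_expansion fps_const \<zeta> * fps_X\<^sup>2 * fps_deriv H" by simp
  from fps_expansion_unique_complex[OF L this]
  have E: "fps_nth (fps_deriv G) n = fps_nth (fps_const \<zeta> * (fps_X\<^sup>2 * fps_deriv H)) n" for n
    by (simp add: mult.assoc)
  have nth: "fps_nth H n = taylor_coeff h n" "fps_nth G n = taylor_coeff g n" for n
    by (simp_all add: H_def G_def taylor_coeff_def)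
  have a1: "taylor_coeff h (Suc 0) = 1" using h by (simp add: taylor_coeff_1)
  show "taylor_coeff g 2 = 0"
    using E[of 1] by (simp add: nth fps_X_power_mult_nth numeral_2_eq_2)
  show "taylor_coeff g 3 = \<zeta> / 3"
    using E[of 2] by (simp add: nth fps_X_power_mult_nth a1 eval_nat_numeral field_simps)
  show "taylor_coeff g 4 = \<zeta> * taylor_coeff h 2 / 2"
    using E[of 3] by (simp add: nth fps_X_power_mult_nth eval_nat_numeral field_simps)
qed

section \<open>The Toeplitz determinant\<close>

lemma toeplitz_det_3_2:
  "toeplitz_det 3 2 F = (taylor_coeff F 2 - taylor_coeff F 4) *
     ((taylor_coeff F 2)\<^sup>2 + taylor_coeff F 2 * taylor_coeff F 4 - 2 * (taylor_coeff F 3)\<^sup>2)"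
proof -
  have lt2: "{..<2::nat} = {0,1}" and lt3: "{..<3::nat} = {0,1,2}" by auto
  have det2: "Determinant.det A = A $$ (0,0) * A $$ (1,1) - A $$ (0,1) * A $$ (1,0)"
    if A: "A \<in> carrier_mat 2 2" for A :: "complex mat"
    using A mat_delete_carrier[OF A, of 0 0] mat_delete_carrier[OF A, of 0 1]
    by (subst laplace_expansion_row[OF A, of 0])
       (auto simp: lt2 Determinant.cofactor_def mat_delete_def det_single)
  define M where "M = mat 3 3 (\<lambda>(i, j). taylor_coeff F (2 + nat \<bar>int i - int j\<bar>))"
  have M: "M \<in> carrier_mat 3 3" by (simp add: M_def)
  have D: "mat_delete M i j \<in> carrier_mat 2 2" for i j
    using mat_delete_carrier[OF M, of i j] by simp
  have "toeplitz_det 3 2 F = Determinant.det M" by (simp add: toeplitz_det_def M_def)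
  also have "\<dots> = (\<Sum>j<3. M $$ (0, j) * Determinant.cofactor M 0 j)"
    by (rule laplace_expansion_row[OF M]) simp
  also have "\<dots> = (taylor_coeff F 2 - taylor_coeff F 4) *
     ((taylor_coeff F 2)\<^sup>2 + taylor_coeff F 2 * taylor_coeff F 4 - 2 * (taylor_coeff F 3)\<^sup>2)"
    unfolding lt3 Determinant.cofactor_def det2[OF D]
    by (simp add: mat_delete_def M_def) (simp add: eval_nat_numeral algebra_simps)
  finally show ?thesis .
qed

section \<open>Bounds for the Toeplitz determinants\<close>

text \<open>
  For \<open>\<mu> \<le> 1\<close> the number inside the norm is a convex combination of \<open>p3\<close> and \<open>p3 - p1 * p2\<close>; for
  larger \<open>\<mu>\<close> the excess \<open>(\<mu> - 1) * p1 * p2\<close> is estimated by the triangle inequality.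
\<close>

lemma norm_diff_scaled_product_le:
  fixes p1 p2 p3 :: complex
  assumes "cmod p1 \<le> 2" "cmod p2 \<le> 2" "cmod p3 \<le> 2" "cmod (p3 - p1 * p2) \<le> 2" "\<mu> \<ge> 0"
  shows "cmod (p3 - of_real \<mu> * p1 * p2) \<le> max 2 (4 * \<mu> - 2)"
proof (cases "\<mu> \<le> 1")
  case True
  have "cmod (p3 - of_real \<mu> * p1 * p2)
      = cmod (of_real (1 - \<mu>) * p3 + of_real \<mu> * (p3 - p1 * p2))"
    by (simp add: algebra_simps)
  also have "\<dots> \<le> (1 - \<mu>) * cmod p3 + \<mu> * cmod (p3 - p1 * p2)"
    using norm_triangle_ineq[of "of_real (1 - \<mu>) * p3" "of_real \<mu> * (p3 - p1 * p2)"] True assms(5)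
    unfolding norm_mult norm_of_real by simp
  also have "\<dots> \<le> (1 - \<mu>) * 2 + \<mu> * 2"
    using True assms by (intro add_mono mult_left_mono) auto
  finally show ?thesis by simp
next
  case False
  have "cmod (p3 - of_real \<mu> * p1 * p2) = cmod ((p3 - p1 * p2) - of_real (\<mu> - 1) * (p1 * p2))"
    by (simp add: algebra_simps)
  also have "\<dots> \<le> cmod (p3 - p1 * p2) + (\<mu> - 1) * (cmod p1 * cmod p2)"
    using norm_triangle_ineq4[of "p3 - p1 * p2" "of_real (\<mu> - 1) * (p1 * p2)"] False
    unfolding norm_mult norm_of_real by simp
  also have "\<dots> \<le> 2 + (\<mu> - 1) * (2 * 2)"
    using False assms by (intro add_mono mult_left_mono mult_mono) auto
  finally show ?thesis by simp
qed

lemma toeplitz_factor_bound: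
  fixes p1 p2 p3 :: complex and b :: real
  assumes p: "cmod p1 \<le> 2" "cmod p2 \<le> 2" "cmod p3 \<le> 2" "cmod (p3 - p1 * p2) \<le> 2"
    and b: "b \<ge> 0"
  defines "a2 \<equiv> of_real b * p1 / 2"
    and "a3 \<equiv> of_real b * (p2 + of_real b * p1\<^sup>2) / 6"
    and "a4 \<equiv> of_real b * (p3 + 3/2 * of_real b * p1 * p2 + (of_real b)\<^sup>2 * p1^3 / 2) / 12"
  shows "cmod (a2 - a4) \<le> b * (7 + 3 * b + 2 * b\<^sup>2) / 6"
    and "cmod (a2\<^sup>2 + a2 * a4 - 2 * a3\<^sup>2) \<le> b\<^sup>2 * (max 25 (19 + 7 * b) + 10 * b\<^sup>2) / 18"
proof -
  have p12: "cmod p1 * cmod p2 \<le> 2 * 2" using p by (intro mult_mono) auto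
  have p1n: "cmod p1 ^ n \<le> 2 ^ n" for n using p by (intro power_mono) auto
  have "a2 - a4 = of_real (b / 12) *
      (6 * p1 - p3 - of_real (3/2 * b) * (p1 * p2) - of_real (b\<^sup>2 / 2) * p1 ^ 3)"
    by (simp add: a2_def a4_def field_simps)
  hence "cmod (a2 - a4) = b / 12 *
      cmod (6 * p1 - p3 - of_real (3/2 * b) * (p1 * p2) - of_real (b\<^sup>2 / 2) * p1 ^ 3)"
    using b by (simp only: norm_mult norm_of_real)
  also have "\<dots> \<le> b / 12 *
      (cmod (6 * p1) + cmod p3 + cmod (of_real (3/2 * b) * (p1 * p2)) + cmod (of_real (b\<^sup>2 / 2) * p1 ^ 3))"
    using b by (intro mult_left_mono order.trans[OF norm_triangle_ineq4] add_right_mono) auto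
  also have "\<dots> = b / 12 * (6 * cmod p1 + cmod p3 + 3/2 * b * (cmod p1 * cmod p2) + b\<^sup>2 / 2 * cmod p1 ^ 3)"
    using b by (simp only: norm_mult norm_of_real norm_power) simp
  also have "\<dots> \<le> b / 12 * (6 * 2 + 2 + 3/2 * b * (2 * 2) + b\<^sup>2 / 2 * 2 ^ 3)"
    using b by (intro mult_left_mono add_mono p p1n p12) auto
  finally show "cmod (a2 - a4) \<le> b * (7 + 3 * b + 2 * b\<^sup>2) / 6"
    by (simp add: field_simps)

  define \<mu> where "\<mu> = 7 * b / 6"
  have L: "cmod (p3 - of_real \<mu> * p1 * p2) \<le> max 2 (4 * \<mu> - 2)"
    using b by (intro norm_diff_scaled_product_le p) (simp add: \<mu>_def)
  \<comment> \<open>The \<open>p3\<close> and \<open>p1\<^sup>2 * p2\<close> terms stay together: bounding them separately loses too much.\<close>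
  define S where "S = 18 * p1\<^sup>2 + 3 * (p1 * (p3 - of_real \<mu> * p1 * p2)) - of_real (5/2 * b\<^sup>2) * p1 ^ 4 - 4 * p2\<^sup>2"
  have "a2\<^sup>2 + a2 * a4 - 2 * a3\<^sup>2 = of_real (b\<^sup>2 / 72) * S"
    by (simp add: a2_def a3_def a4_def S_def \<mu>_def field_simps eval_nat_numeral)
  hence "cmod (a2\<^sup>2 + a2 * a4 - 2 * a3\<^sup>2) = b\<^sup>2 / 72 * cmod S"
    by (simp only: norm_mult norm_of_real) simp
  also have "cmod S \<le> cmod (18 * p1\<^sup>2) + cmod (3 * (p1 * (p3 - of_real \<mu> * p1 * p2)))
      + cmod (of_real (5/2 * b\<^sup>2) * p1 ^ 4) + cmod (4 * p2\<^sup>2)"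
    unfolding S_def
    by (intro order.trans[OF norm_triangle_ineq4] add_right_mono norm_triangle_ineq)
  also have "\<dots> = 18 * cmod p1 ^ 2 + 3 * (cmod p1 * cmod (p3 - of_real \<mu> * p1 * p2))
      + 5/2 * b\<^sup>2 * cmod p1 ^ 4 + 4 * cmod p2 ^ 2"
    by (simp only: norm_mult norm_of_real norm_power norm_numeral) simp
  also have "\<dots> \<le> 18 * 2 ^ 2 + 3 * (2 * max 2 (4 * \<mu> - 2)) + 5/2 * b\<^sup>2 * 2 ^ 4 + 4 * 2 ^ 2"
    by (intro add_mono mult_left_mono mult_mono p p1n L power_mono) auto
  also have "\<dots> = 4 * (max 25 (19 + 7 * b) + 10 * b\<^sup>2)"
    by (simp add: \<mu>_def max_def)
  finally have "cmod (a2\<^sup>2 + a2 * a4 - 2 * a3\<^sup>2) \<le> b\<^sup>2 / 72 * (4 * (max 25 (19 + 7 * b) + 10 * b\<^sup>2))"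
    by (simp add: mult_left_mono)
  also have "\<dots> = b\<^sup>2 * (max 25 (19 + 7 * b) + 10 * b\<^sup>2) / 18"
    by (simp add: algebra_simps)
  finally show "cmod (a2\<^sup>2 + a2 * a4 - 2 * a3\<^sup>2) \<le> b\<^sup>2 * (max 25 (19 + 7 * b) + 10 * b\<^sup>2) / 18" .
qed

lemma convex_class_K_caratheodory:
  assumes h: "h \<in> convex_class_K \<alpha>" and \<alpha>: "\<alpha> < 1"
  obtains p where "p holomorphic_on ball 0 1" "p 0 = 1"
    "\<forall>z\<in>ball 0 1. Re (p z) \<ge> 0"
    "\<forall>z\<in>ball 0 1. z * deriv (deriv h) z = of_real (1 - \<alpha>) * (p z - 1) * deriv h z"
proof
  define p where "p = (\<lambda>z. (1 + z * deriv (deriv h) z / deriv h z - of_real \<alpha>) / of_real (1 - \<alpha>))"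
  have h': "h holomorphic_on ball 0 1"
    "\<And>z. z \<in> ball 0 1 \<Longrightarrow> deriv h z \<noteq> 0"
    "\<And>z. z \<in> ball 0 1 \<Longrightarrow> Re (1 + z * deriv (deriv h) z / deriv h z) > \<alpha>"
    using h by (auto simp: convex_class_K_def)
  show "p holomorphic_on ball 0 1"
    unfolding p_def using \<alpha> h' by (intro holomorphic_intros) (auto simp flip: of_real_diff)
  show "p 0 = 1" using \<alpha> by (simp add: p_def)
  show "\<forall>z\<in>ball 0 1. Re (p z) \<ge> 0"
  proof
    fix z :: complex assume "z \<in> ball 0 1"
    thus "Re (p z) \<ge> 0"
      using h'(3)[of z] \<alpha> by (simp only: p_def Re_divide_of_real) simp
  qed
  have "(1 - of_real \<alpha> :: complex) \<noteq> 0" using \<alpha> by simp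
  thus "\<forall>z\<in>ball 0 1. z * deriv (deriv h) z = of_real (1 - \<alpha>) * (p z - 1) * deriv h z"
    using h'(2) by (simp add: p_def field_simps)
qed

lemma convex_class_K_toeplitz_bound:
  assumes h: "h \<in> convex_class_K \<alpha>" and \<alpha>: "\<alpha> < 1"
  defines "b \<equiv> 1 - \<alpha>"
  shows "cmod (toeplitz_det 3 2 h) \<le>
      b ^ 3 * (7 + 3 * b + 2 * b\<^sup>2) * (max 25 (19 + 7 * b) + 10 * b\<^sup>2) / 108"
    and "cmod (taylor_coeff h 2) \<le> b"
proof -
  obtain p where p: "p holomorphic_on ball 0 1" "p 0 = 1"
    "\<forall>z\<in>ball 0 1. Re (p z) \<ge> 0"
    "\<forall>z\<in>ball 0 1. z * deriv (deriv h) z = of_real b * (p z - 1) * deriv h z"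
    unfolding b_def using convex_class_K_caratheodory[OF h \<alpha>] by blast
  have hh: "h holomorphic_on ball 0 1" "deriv h 0 = 1" using h by (auto simp: convex_class_K_def)
  have b: "b \<ge> 0" using \<alpha> by (simp add: b_def)
  note C = taylor_coeffs_of_log_derivative[OF hh p(1,2,4)]
  have P: "cmod (taylor_coeff p 1) \<le> 2" "cmod (taylor_coeff p 2) \<le> 2" "cmod (taylor_coeff p 3) \<le> 2"
    by (rule caratheodory_coeff_bound[OF p(1-3)], simp)+
  note B = toeplitz_factor_bound[OF P caratheodory_coeff_3_bound[OF p(1-3)] b, folded C]
  have "cmod (toeplitz_det 3 2 h) \<le> (b * (7 + 3 * b + 2 * b\<^sup>2) / 6) *
      (b\<^sup>2 * (max 25 (19 + 7 * b) + 10 * b\<^sup>2) / 18)"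
    unfolding toeplitz_det_3_2 norm_mult using b by (intro mult_mono B) auto
  thus "cmod (toeplitz_det 3 2 h) \<le>
      b ^ 3 * (7 + 3 * b + 2 * b\<^sup>2) * (max 25 (19 + 7 * b) + 10 * b\<^sup>2) / 108"
    by (simp add: power3_eq_cube power2_eq_square mult_ac)
  have "cmod (taylor_coeff h 2) = b * cmod (taylor_coeff p 1) / 2"
    using b by (simp add: C norm_mult norm_divide)
  also have "\<dots> \<le> b * 2 / 2" using b by (intro divide_right_mono mult_left_mono P) auto
  finally show "cmod (taylor_coeff h 2) \<le> b" by simp
qed

lemma harmonic_class_M2_toeplitz_g:
  assumes "harmonic_class_M2 \<alpha> \<zeta> f h g"
  shows "toeplitz_det 3 2 g = 2 * (taylor_coeff g 3)\<^sup>2 * taylor_coeff g 4"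
    and "toeplitz_det 3 2 g = \<zeta> ^ 3 * taylor_coeff h 2 / 9"
proof -
  have "h holomorphic_on ball 0 1" "deriv h 0 = 1" "g holomorphic_on ball 0 1"
    "\<forall>z\<in>ball 0 1. deriv g z = \<zeta> * z\<^sup>2 * deriv h z"
    using assms by (auto simp: harmonic_class_M2_def harmonic_class_H_def)
  note C = taylor_coeffs_coanalytic[OF this]
  show "toeplitz_det 3 2 g = 2 * (taylor_coeff g 3)\<^sup>2 * taylor_coeff g 4"
    by (simp add: toeplitz_det_3_2 C)
  show "toeplitz_det 3 2 g = \<zeta> ^ 3 * taylor_coeff h 2 / 9"
    by (simp add: toeplitz_det_3_2 C power3_eq_cube power2_eq_square)
qed

section \<open>The extremal functions\<close>

lemma has_field_derivative_contour_integral_linepath_0: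
  assumes "F holomorphic_on ball 0 1" "z \<in> ball 0 1"
  shows "((\<lambda>z. contour_integral (linepath 0 z) F) has_field_derivative F z) (at z)"
proof -
  obtain G where G: "\<And>x. x \<in> ball 0 1 \<Longrightarrow> (G has_field_derivative F x) (at x within ball 0 1)"
    using holomorphic_convex_primitive'[OF convex_ball open_ball assms(1)] by blast
  have "contour_integral (linepath 0 w) F = G w - G 0" if w: "w \<in> ball 0 1" for w
  proof -
    have "(F has_contour_integral (G (pathfinish (linepath 0 w)) - G (pathstart (linepath 0 w))))
        (linepath 0 w)"
      using w by (intro contour_integral_primitive[OF G])
        (simp_all add: closed_segment_subset)
    thus ?thesis by (simp add: contour_integral_unique)
  qed
  moreover have "((\<lambda>w. G w - G 0) has_field_derivative F z) (at z)"
    using G[OF assms(2)] at_within_open[OF assms(2) open_ball]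
    by (auto intro!: derivative_eq_intros)
  ultimately show ?thesis
    using has_field_derivative_transform_within_open[of "\<lambda>w. G w - G 0" "F z" z "ball 0 1"] assms(2)
    by auto
qed

text \<open>
  For \<open>z\<close> in the disc the base \<open>1 - \<delta> * z\<close> has positive real part, so its principal powers are
  holomorphic there.
\<close>

context
  fixes \<alpha> :: real and \<delta> :: complex
  assumes \<delta>: "cmod \<delta> = 1"
begin

lemma Re_extremal_base_pos:
  assumes "z \<in> ball 0 1"
  shows "Re (1 - \<delta> * z) > 0"
  using complex_Re_le_cmod[of "\<delta> * z"] assms \<delta> by (simp add: norm_mult)

lemma extremal_base_nonzero:
  assumes "z \<in> ball 0 1"
  shows "1 - \<delta> * z \<noteq> 0" "1 - \<delta> * z \<notin> \<real>\<^sub>\<le>\<^sub>0"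
proof -
  show "1 - \<delta> * z \<noteq> 0"
    using Re_extremal_base_pos[OF assms] by (metis less_irrefl zero_complex.sel(1))
  show "1 - \<delta> * z \<notin> \<real>\<^sub>\<le>\<^sub>0"
    using Re_extremal_base_pos[OF assms] by (simp only: complex_nonpos_Reals_iff) linarith
qed

lemma has_field_derivative_extremal_integrand:
  assumes "z \<in> ball 0 1"
  shows "((\<lambda>t. 1 / (1 - \<delta> * t) powr of_real (2 - 2 * \<alpha>)) has_field_derivative
      of_real (2 - 2 * \<alpha>) * \<delta> / (1 - \<delta> * z) * (1 / (1 - \<delta> * z) powr of_real (2 - 2 * \<alpha>))) (at z)"
proof -
  have "((\<lambda>t. (1 - \<delta> * t) powr (- of_real (2 - 2 * \<alpha>))) has_field_derivative
      - of_real (2 - 2 * \<alpha>) * (1 - \<delta> * z) powr (- of_real (2 - 2 * \<alpha>) - 1) * (- \<delta>)) (at z)"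
    using extremal_base_nonzero[OF assms] by (auto intro!: derivative_eq_intros)
  thus ?thesis
    using extremal_base_nonzero[OF assms]
    by (simp add: powr_minus_divide powr_diff mult_ac del: of_real_diff)
qed

lemma extremal_integrand_holomorphic:
  "(\<lambda>t. 1 / (1 - \<delta> * t) powr of_real (2 - 2 * \<alpha>)) holomorphic_on ball 0 1"
  unfolding holomorphic_on_open[OF open_ball] using has_field_derivative_extremal_integrand by blast

lemma has_field_derivative_extremal_h:
  assumes "z \<in> ball 0 1"
  shows "(extremal_h \<alpha> \<delta> has_field_derivative 1 / (1 - \<delta> * z) powr of_real (2 - 2 * \<alpha>)) (at z)"
  unfolding extremal_h_def[abs_def]
  by (intro has_field_derivative_contour_integral_linepath_0 assms extremal_integrand_holomorphic)

lemma has_field_derivative_extremal_g: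
  assumes "z \<in> ball 0 1"
  shows "(extremal_g \<alpha> \<delta> \<zeta> has_field_derivative
      \<zeta> * z\<^sup>2 / (1 - \<delta> * z) powr of_real (2 - 2 * \<alpha>)) (at z)"
proof -
  have "(\<lambda>t. \<zeta> * t\<^sup>2 * (1 / (1 - \<delta> * t) powr of_real (2 - 2 * \<alpha>))) holomorphic_on ball 0 1"
    by (intro holomorphic_on_mult extremal_integrand_holomorphic holomorphic_intros)
  from has_field_derivative_contour_integral_linepath_0[OF this assms] show ?thesis
    by (simp add: extremal_g_def[abs_def])
qed

lemma deriv_deriv_extremal_h:
  assumes "z \<in> ball 0 1"
  shows "deriv (deriv (extremal_h \<alpha> \<delta>)) z =
      of_real (2 - 2 * \<alpha>) * \<delta> / (1 - \<delta> * z) * deriv (extremal_h \<alpha> \<delta>) z"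
proof -
  have "(deriv (extremal_h \<alpha> \<delta>) has_field_derivative
      of_real (2 - 2 * \<alpha>) * \<delta> / (1 - \<delta> * z) * (1 / (1 - \<delta> * z) powr of_real (2 - 2 * \<alpha>))) (at z)"
    by (rule has_field_derivative_transform_within_open[OF
          has_field_derivative_extremal_integrand[OF assms] open_ball assms])
       (simp add: DERIV_imp_deriv[OF has_field_derivative_extremal_h])
  thus ?thesis
    unfolding DERIV_imp_deriv[OF has_field_derivative_extremal_h[OF assms]] by (rule DERIV_imp_deriv)
qed

lemma extremal_h_in_convex_class_K:
  assumes \<alpha>: "\<alpha> < 1"
  shows "extremal_h \<alpha> \<delta> \<in> convex_class_K \<alpha>"
  unfolding convex_class_K_def
proof (intro CollectI conjI ballI)
  note D = has_field_derivative_extremal_h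
  show "extremal_h \<alpha> \<delta> holomorphic_on ball 0 1" 
    unfolding holomorphic_on_open[OF open_ball] using D by blast
  show "extremal_h \<alpha> \<delta> 0 = 0" by (simp add: extremal_h_def)
  show "deriv (extremal_h \<alpha> \<delta>) 0 = 1" using DERIV_imp_deriv[OF D[of 0]] by simp
  fix z :: complex assume z: "z \<in> ball 0 1"
  note nz = extremal_base_nonzero[OF z]
  show nz': "deriv (extremal_h \<alpha> \<delta>) z \<noteq> 0" using DERIV_imp_deriv[OF D[OF z]] nz by simp
  define w where "w = \<delta> * z"
  have "cmod w < 1" using z \<delta> by (simp add: w_def norm_mult)
  have w1: "1 - w \<noteq> 0" using nz by (simp add: w_def)
  have "Re (w / (1 - w)) > - 1 / 2"
  proof -
    have "(1 + w) / (1 - w) = w / (1 - w) + w / (1 - w) + 1"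
      using w1 by (simp add: nonzero_eq_divide_eq nonzero_divide_eq_eq distrib_right)
    hence "Re ((1 + w) / (1 - w)) = Re (w / (1 - w)) + Re (w / (1 - w)) + 1"
      by (simp only: plus_complex.sel one_complex.sel)
    moreover have "Re ((1 + w) / (1 - w)) > 0"
    proof -
      have "Re ((1 + w) / (1 - w)) = (1 - (cmod w)\<^sup>2) / (cmod (1 - w))\<^sup>2"
        unfolding cmod_power2 Re_divide by (simp add: power2_eq_square algebra_simps)
      also have "\<dots> > 0" using \<open>cmod w < 1\<close> w1 by (simp add: abs_square_less_1)
      finally show ?thesis .
    qed
    ultimately show ?thesis by simp
  qed
  hence "(2 - 2 * \<alpha>) * Re (w / (1 - w)) > (2 - 2 * \<alpha>) * (- 1 / 2)"
    using \<alpha> by (intro mult_strict_left_mono) auto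
  moreover have "1 + z * deriv (deriv (extremal_h \<alpha> \<delta>)) z / deriv (extremal_h \<alpha> \<delta>) z =
      1 + of_real (2 - 2 * \<alpha>) * (w / (1 - w))"
    using nz' by (simp add: deriv_deriv_extremal_h[OF z] w_def del: of_real_diff)
  ultimately show "Re (1 + z * deriv (deriv (extremal_h \<alpha> \<delta>)) z / deriv (extremal_h \<alpha> \<delta>) z) > \<alpha>"
    by (simp only: plus_complex.sel Re_complex_of_real one_complex.sel times_complex.sel
        Im_complex_of_real mult_zero_left diff_zero) (simp add: field_simps)
qed

lemma extremal_in_harmonic_class_M2:
  assumes \<alpha>: "\<alpha> < 1" and \<zeta>: "cmod \<zeta> \<le> 1/3"
  shows "harmonic_class_M2 \<alpha> \<zeta> (\<lambda>z. extremal_h \<alpha> \<delta> z + cnj (extremal_g \<alpha> \<delta> \<zeta> z))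
             (extremal_h \<alpha> \<delta>) (extremal_g \<alpha> \<delta> \<zeta>)"
proof -
  have K: "extremal_h \<alpha> \<delta> \<in> convex_class_K \<alpha>" by (rule extremal_h_in_convex_class_K[OF \<alpha>])
  have G: "extremal_g \<alpha> \<delta> \<zeta> holomorphic_on ball 0 1"
    unfolding holomorphic_on_open[OF open_ball] using has_field_derivative_extremal_g by blast
  have D: "deriv (extremal_g \<alpha> \<delta> \<zeta>) z = \<zeta> * z\<^sup>2 * deriv (extremal_h \<alpha> \<delta>) z" if "z \<in> ball 0 1" for z
    using DERIV_imp_deriv[OF has_field_derivative_extremal_h[OF that]]
      DERIV_imp_deriv[OF has_field_derivative_extremal_g[OF that]] by simp
  have "cmod (deriv (extremal_g \<alpha> \<delta> \<zeta>) z) < cmod (deriv (extremal_h \<alpha> \<delta>) z)" if z: "z \<in> ball 0 1" for z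
  proof -
    have "cmod \<zeta> * (cmod z)\<^sup>2 \<le> 1/3 * 1"
      using z \<zeta> by (intro mult_mono) (auto simp: power_le_one)
    hence "cmod (\<zeta> * z\<^sup>2) < 1" by (simp add: norm_mult norm_power)
    moreover have "cmod (deriv (extremal_h \<alpha> \<delta>) z) > 0" using K z by (auto simp: convex_class_K_def)
    ultimately show ?thesis unfolding D[OF z] norm_mult[of "\<zeta> * z\<^sup>2"] by simp
  qed
  thus ?thesis using K G D
    by (auto simp: harmonic_class_M2_def harmonic_class_H_def convex_class_K_def extremal_g_def)
qed

text \<open>
  The Caratheodory function of the extremal map is \<open>(1 + \<delta> z) / (1 - \<delta> z)\<close>, with coefficients
  \<open>2 * \<delta> ^ n\<close> for \<open>n > 0\<close>.
\<close>

lemma extremal_h_coeffs: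
  assumes \<alpha>: "\<alpha> < 1"
  defines "b \<equiv> complex_of_real (1 - \<alpha>)"
  shows "taylor_coeff (extremal_h \<alpha> \<delta>) 2 = b * \<delta>"
    and "taylor_coeff (extremal_h \<alpha> \<delta>) 3 = b * (1 + 2 * b) / 3 * \<delta>\<^sup>2"
    and "taylor_coeff (extremal_h \<alpha> \<delta>) 4 = b * (1 + 3 * b + 2 * b\<^sup>2) / 6 * \<delta> ^ 3"
proof -
  define p where "p = (\<lambda>z. (1 + \<delta> * z) / (1 - \<delta> * z))"
  have hol: "p holomorphic_on ball 0 1" unfolding p_def
    using extremal_base_nonzero by (intro holomorphic_intros) auto
  define P where "P = fps_expansion p 0"
  have P: "p has_fps_expansion P"
    unfolding P_def using hol by (auto intro!: has_fps_expansion_fps_expansion[of "ball 0 1"])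
  have "eventually (\<lambda>z. p z * (1 - \<delta> * z) = 1 + \<delta> * z) (nhds 0)"
    using eventually_nhds_in_open[of "ball 0 1" "0::complex"]
    by (rule eventually_mono) (use extremal_base_nonzero in \<open>auto simp: p_def\<close>)
  from has_fps_expansion_cong[OF this refl]
  have "(\<lambda>z. p z * (1 - \<delta> * z)) has_fps_expansion (1 + fps_const \<delta> * fps_X)"
    by (simp add: has_fps_expansion_add has_fps_expansion_cmult_left has_fps_expansion_fps_X)
  moreover have "(\<lambda>z. p z * (1 - \<delta> * z)) has_fps_expansion P * (1 - fps_const \<delta> * fps_X)"
    by (intro has_fps_expansion_mult has_fps_expansion_diff has_fps_expansion_1
        has_fps_expansion_cmult_left has_fps_expansion_fps_X P)
  ultimately have "P * (1 - fps_const \<delta> * fps_X) = 1 + fps_const \<delta> * fps_X"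
    by (rule fps_expansion_unique_complex[rotated])
  hence "P = 1 + fps_const \<delta> * fps_X + fps_const \<delta> * (fps_X * P)"
    by (simp add: algebra_simps)
  hence E: "fps_nth P n = fps_nth (1 + fps_const \<delta> * fps_X + fps_const \<delta> * (fps_X * P)) n" for n
    by simp
  have nth: "taylor_coeff p n = fps_nth P n" for n by (simp add: P_def taylor_coeff_def)
  have P0: "fps_nth P 0 = 1" using E[of 0] by simp
  have P1: "fps_nth P 1 = 2 * \<delta>" using E[of 1] P0 by simp
  have P2: "fps_nth P 2 = 2 * \<delta>\<^sup>2" using E[of 2] P1 by (simp add: power2_eq_square)
  have P3: "fps_nth P 3 = 2 * \<delta> ^ 3" using E[of 3] P2 by (simp add: eval_nat_numeral)
  have "extremal_h \<alpha> \<delta> holomorphic_on ball 0 1" "deriv (extremal_h \<alpha> \<delta>) 0 = 1"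
    using extremal_h_in_convex_class_K[OF \<alpha>] by (auto simp: convex_class_K_def)
  moreover have "\<forall>z\<in>ball 0 1. z * deriv (deriv (extremal_h \<alpha> \<delta>)) z
      = b * (p z - 1) * deriv (extremal_h \<alpha> \<delta>) z"
  proof
    fix z :: complex assume z: "z \<in> ball 0 1"
    show "z * deriv (deriv (extremal_h \<alpha> \<delta>)) z
        = b * (p z - 1) * deriv (extremal_h \<alpha> \<delta>) z"
      using extremal_base_nonzero(1)[OF z] unfolding deriv_deriv_extremal_h[OF z]
      by (simp add: p_def b_def field_simps)
  qed
  ultimately have C: "taylor_coeff (extremal_h \<alpha> \<delta>) 2 = b * (2 * \<delta>) / 2"
    "taylor_coeff (extremal_h \<alpha> \<delta>) 3 = b * (2 * \<delta>\<^sup>2 + b * (2 * \<delta>)\<^sup>2) / 6"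
    "taylor_coeff (extremal_h \<alpha> \<delta>) 4
       = b * (2 * \<delta> ^ 3 + 3/2 * b * (2 * \<delta>) * (2 * \<delta>\<^sup>2) + b\<^sup>2 * (2 * \<delta>)^3 / 2) / 12"
    using taylor_coeffs_of_log_derivative[of "extremal_h \<alpha> \<delta>" p b] hol
    unfolding nth P1 P2 P3 by (auto simp: p_def)
  show "taylor_coeff (extremal_h \<alpha> \<delta>) 2 = b * \<delta>" by (simp add: C)
  show "taylor_coeff (extremal_h \<alpha> \<delta>) 3 = b * (1 + 2 * b) / 3 * \<delta>\<^sup>2"
    unfolding C by (simp add: field_simps power2_eq_square)
  show "taylor_coeff (extremal_h \<alpha> \<delta>) 4 = b * (1 + 3 * b + 2 * b\<^sup>2) / 6 * \<delta> ^ 3"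
    unfolding C by (simp add: field_simps power2_eq_square power3_eq_cube)
qed

end

text \<open>
  At \<open>\<delta> = \<i>\<close> the coefficients \<open>a\<^sub>2\<close> and \<open>a\<^sub>4\<close> are purely imaginary with opposite signs and
  \<open>a\<^sub>3\<close> is real and negative, so \<open>|a\<^sub>2 - a\<^sub>4| = |a\<^sub>2| + |a\<^sub>4|\<close>,
  and the second factor of the determinant is \<open>- (|a\<^sub>2|\<^sup>2 + 2 |a\<^sub>3|\<^sup>2 - |a\<^sub>2| |a\<^sub>4|)\<close>.
\<close>

lemma toeplitz_det_extremal_h:
  assumes \<alpha>: "\<alpha> < 1"
  defines "b \<equiv> 1 - \<alpha>"
  shows "cmod (toeplitz_det 3 2 (extremal_h \<alpha> \<i>)) =
    b ^ 3 * (7 + 3 * b + 2 * b\<^sup>2) * (19 + 7 * b + 10 * b\<^sup>2) / 108"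
proof -
  have b: "b \<ge> 0" using \<alpha> by (simp add: b_def)
  define A2 A3 A4 where "A2 = b" and "A3 = b * (1 + 2 * b) / 3"
    and "A4 = b * (1 + 3 * b + 2 * b\<^sup>2) / 6"
  have coeffs: "taylor_coeff (extremal_h \<alpha> \<i>) 2 = \<i> * of_real A2"
    "taylor_coeff (extremal_h \<alpha> \<i>) 3 = - of_real A3"
    "taylor_coeff (extremal_h \<alpha> \<i>) 4 = - (\<i> * of_real A4)"
    unfolding extremal_h_coeffs[OF norm_ii \<alpha>, folded b_def] by (simp_all add: A2_def A3_def A4_def power3_eq_cube)
  have "toeplitz_det 3 2 (extremal_h \<alpha> \<i>) =
      - \<i> * of_real ((A2 + A4) * (A2\<^sup>2 + 2 * A3\<^sup>2 - A2 * A4))"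
    unfolding toeplitz_det_3_2 coeffs
    by (simp add: algebra_simps power2_eq_square)
  also have "cmod \<dots> = \<bar>(A2 + A4) * (A2\<^sup>2 + 2 * A3\<^sup>2 - A2 * A4)\<bar>"
    by (simp only: norm_mult norm_of_real norm_minus_cancel norm_ii mult_1)
  also have "(A2 + A4) * (A2\<^sup>2 + 2 * A3\<^sup>2 - A2 * A4)
      = b ^ 3 * (7 + 3 * b + 2 * b\<^sup>2) * (19 + 7 * b + 10 * b\<^sup>2) / 108"
    by (simp add: A2_def A3_def A4_def field_simps power2_eq_square power3_eq_cube)
  also have "\<bar>\<dots>\<bar> = b ^ 3 * (7 + 3 * b + 2 * b\<^sup>2) * (19 + 7 * b + 10 * b\<^sup>2) / 108"
    using b by (intro abs_of_nonneg divide_nonneg_nonneg mult_nonneg_nonneg) auto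
  finally show ?thesis .
qed

section \<open>The sharp bounds\<close>

theorem theorem3p3:
  fixes \<alpha> :: real and \<zeta> :: complex
  assumes "-1/2 \<le> \<alpha>" and "\<alpha> < 1" and "cmod \<zeta> \<le> 1/3"
  shows
    "(\<forall>f h g. harmonic_class_M2 \<alpha> \<zeta> f h g \<longrightarrow>
        (\<alpha> \<le> 1/7 \<longrightarrow> cmod (toeplitz_det 3 2 h)
           \<le> 1/108 * (1 - \<alpha>)^3 * (2*\<alpha>\<^sup>2 - 7*\<alpha> + 12) * (10*\<alpha>\<^sup>2 - 27*\<alpha> + 36)) \<and>
        (1/7 \<le> \<alpha> \<longrightarrow> cmod (toeplitz_det 3 2 h)
           \<le> 5/108 * (1 - \<alpha>)^3 * (2*\<alpha>\<^sup>2 - 7*\<alpha> + 12) * (2*\<alpha>\<^sup>2 - 4*\<alpha> + 7)) \<and>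
        cmod (toeplitz_det 3 2 g) = cmod (2 * (taylor_coeff g 3)\<^sup>2 * taylor_coeff g 4) \<and>
        cmod (toeplitz_det 3 2 g) \<le> 1/243 * (1 - \<alpha>)) \<and>
     (\<alpha> \<le> 1/7 \<longrightarrow>
        (\<exists>\<delta>. cmod \<delta> = 1 \<and>
           harmonic_class_M2 \<alpha> \<zeta> (\<lambda>z. extremal_h \<alpha> \<delta> z + cnj (extremal_g \<alpha> \<delta> \<zeta> z))
             (extremal_h \<alpha> \<delta>) (extremal_g \<alpha> \<delta> \<zeta>) \<and>
           cmod (toeplitz_det 3 2 (extremal_h \<alpha> \<delta>))
             = 1/108 * (1 - \<alpha>)^3 * (2*\<alpha>\<^sup>2 - 7*\<alpha> + 12) * (10*\<alpha>\<^sup>2 - 27*\<alpha> + 36))) \<and>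
     (\<exists>\<delta> \<zeta>'. cmod \<delta> = 1 \<and> cmod \<zeta>' \<le> 1/3 \<and>
        harmonic_class_M2 \<alpha> \<zeta>' (\<lambda>z. extremal_h \<alpha> \<delta> z + cnj (extremal_g \<alpha> \<delta> \<zeta>' z))
          (extremal_h \<alpha> \<delta>) (extremal_g \<alpha> \<delta> \<zeta>') \<and>
        cmod (toeplitz_det 3 2 (extremal_g \<alpha> \<delta> \<zeta>')) = 1/243 * (1 - \<alpha>))"
    (is "?bounds \<and> ?sharp_h \<and> ?sharp_g")
proof (intro conjI)
  define b where "b = 1 - \<alpha>"
  \<comment> \<open>The polynomials of the statement, rewritten in \<open>b\<close>.\<close>
  have poly1: "2*\<alpha>\<^sup>2 - 7*\<alpha> + 12 = 7 + 3 * b + 2 * b\<^sup>2"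
    and poly2: "10*\<alpha>\<^sup>2 - 27*\<alpha> + 36 = 19 + 7 * b + 10 * b\<^sup>2"
    and poly3: "5 * (2*\<alpha>\<^sup>2 - 4*\<alpha> + 7) = 25 + 10 * b\<^sup>2"
    by (simp_all add: b_def power2_eq_square algebra_simps)
  show ?bounds
  proof (intro allI impI conjI)
    fix f h g assume M: "harmonic_class_M2 \<alpha> \<zeta> f h g"
    hence h: "h \<in> convex_class_K \<alpha>" by (simp add: harmonic_class_M2_def)
    note B = convex_class_K_toeplitz_bound[OF h assms(2), folded b_def]
    show "cmod (toeplitz_det 3 2 h)
        \<le> 1/108 * (1 - \<alpha>)^3 * (2*\<alpha>\<^sup>2 - 7*\<alpha> + 12) * (10*\<alpha>\<^sup>2 - 27*\<alpha> + 36)" if "\<alpha> \<le> 1/7"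
    proof -
      have "max 25 (19 + 7 * b) = 19 + 7 * b" using that by (simp add: b_def)
      thus ?thesis using B(1) unfolding poly1 poly2 b_def[symmetric] by (simp add: mult_ac)
    qed
    show "cmod (toeplitz_det 3 2 h)
        \<le> 5/108 * (1 - \<alpha>)^3 * (2*\<alpha>\<^sup>2 - 7*\<alpha> + 12) * (2*\<alpha>\<^sup>2 - 4*\<alpha> + 7)" if "1/7 \<le> \<alpha>"
    proof -
      have "max 25 (19 + 7 * b) = 25" using that by (simp add: b_def)
      moreover have "5/108 * (1 - \<alpha>)^3 * (2*\<alpha>\<^sup>2 - 7*\<alpha> + 12) * (2*\<alpha>\<^sup>2 - 4*\<alpha> + 7)
          = b ^ 3 * (7 + 3 * b + 2 * b\<^sup>2) * (25 + 10 * b\<^sup>2) / 108"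
        unfolding poly1 poly3[symmetric] b_def[symmetric] by simp
      ultimately show ?thesis using B(1) by (simp only:)
    qed
    note G = harmonic_class_M2_toeplitz_g[OF M]
    show "cmod (toeplitz_det 3 2 g) = cmod (2 * (taylor_coeff g 3)\<^sup>2 * taylor_coeff g 4)"
      by (simp only: G(1))
    have "cmod (toeplitz_det 3 2 g) = cmod \<zeta> ^ 3 * cmod (taylor_coeff h 2) / 9"
      by (simp add: G(2) norm_mult norm_divide norm_power)
    also have "\<dots> \<le> (1/3) ^ 3 * b / 9"
      using assms(3) B(2) by (intro divide_right_mono mult_mono power_mono) auto
    finally show "cmod (toeplitz_det 3 2 g) \<le> 1/243 * (1 - \<alpha>)"
      by (simp add: b_def power3_eq_cube)
  qed
  show ?sharp_h
    using extremal_in_harmonic_class_M2[OF norm_ii assms(2,3)] toeplitz_det_extremal_h[OF assms(2)]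
    unfolding poly1 poly2 b_def by (intro impI exI[of _ \<i>]) simp
  have M: "harmonic_class_M2 \<alpha> (1/3) (\<lambda>z. extremal_h \<alpha> 1 z + cnj (extremal_g \<alpha> 1 (1/3) z))
          (extremal_h \<alpha> 1) (extremal_g \<alpha> 1 (1/3))"
    using assms(2) by (intro extremal_in_harmonic_class_M2) auto
  have "toeplitz_det 3 2 (extremal_g \<alpha> 1 (1/3)) = of_real (1/243 * (1 - \<alpha>))"
    unfolding harmonic_class_M2_toeplitz_g(2)[OF M] extremal_h_coeffs(1)[OF norm_one assms(2)]
    by (simp add: power3_eq_cube)
  hence "cmod (toeplitz_det 3 2 (extremal_g \<alpha> 1 (1/3))) = 1/243 * (1 - \<alpha>)"
    using assms(2) by (simp only: norm_of_real) simp
  thus ?sharp_g using M by (intro exI[of _ 1] exI[of _ "1/3"]) simp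
qed

end
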